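(* Let $R$ be a commutative ring with unity, let $M$ be an $R$-module with $\operatorname{Spec}(M)\neq\emptyset$, and let $N\subseteq\widetilde{\operatorname{Spec}(M)}$ be a subset. Then: (i) $\overline{N}=\{Q\in\operatorname{Spec}(M) \mid (P:M)\subseteq(Q:M) \text{ for some } P\in N\}$. (ii) $\overline{\bigcup_{i\in I}N_i}=\bigcup_{i\in I}\overline{N_i}$ for every family $\{N_i\}_{i\in I}$ of subsets of $\widetilde{\operatorname{Spec}(M)}$. (iii) $N^\circ=\{P\in N \mid \widetilde{D}(R-(P:M))\subseteq N\}$. (iv) If $M$ is a multiplication module, then $N'=\overline{N}-\{P\in N \mid P \text{ is a minimal element of } N\}$.
   Context: For a submodule $K$ of an $R$-module $M$, $(K:M)=\{r\in R : rM\subseteq K\}$. A proper submodule $P$ of $M$ is prime if whenever $rm\in P$ with $r\in R$, $m\in M$, then $m\in P$ or $r\in(P:M)$; in this case $(P:M)$ is a prime ideal of $R$. $\operatorname{Spec}(M)$ is the set of all prime submodules of $M$. A subset $T\subseteq R$ is multiplicatively closed if $1\in T$ and $xy\in T$ whenever $x,y\in T$. For a family $\mathcal{S}=\{S_i\}_{i\in I}$ of multiplicatively closed subsets of $R$, $\widetilde{V}(\mathcal{S})=\{P\in\operatorname{Spec}(M) \mid (P:M)\cap S_i\neq\emptyset \text{ for all } i\in I\}$. $\widetilde{\operatorname{Spec}(M)}$ denotes the set $\operatorname{Spec}(M)$ with the topology whose closed sets are exactly the sets $\widetilde{V}(\mathcal{S})$, $\mathcal{S}$ ranging over all families of multiplicatively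 closed subsets of $R$. For a multiplicatively closed subset $T$ of $R$, $\widetilde{D}(T)=\{P\in\operatorname{Spec}(M) \mid (P:M)\cap T=\emptyset\}$, an open set; $R-(P:M)$ is the set complement of $(P:M)$ in $R$. $\overline{N}$, $N^\circ$ and $N'$ denote the closure, the interior and the set of limit points of $N$ in $\widetilde{\operatorname{Spec}(M)}$. Minimal elements of $N$ are taken with respect to inclusion of submodules. $M$ is a multiplication module if every submodule $K$ of $M$ has the form $K=JM$ for some ideal $J$ of $R$ (equivalently $K=(K:M)M$). *)

theory Defs
  imports "HOL-Analysis.Abstract_Topology" "HOL-Algebra.Ideal" "HOL-Algebra.Module"
begin

definition colon :: "('a, 'r) ring_scheme \<Rightarrow> ('a, 'b, 'm) module_scheme \<Rightarrow> 'b set \<Rightarrow> 'a set"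
  where "colon R M K = {r \<in> carrier R. \<forall>m \<in> carrier M. r \<odot>\<^bsub>M\<^esub> m \<in> K}"

definition prime_submodule :: "('a, 'r) ring_scheme \<Rightarrow> ('a, 'b, 'm) module_scheme \<Rightarrow> 'b set \<Rightarrow> bool"
  where "prime_submodule R M P \<longleftrightarrow>
    submodule P R M \<and> P \<noteq> carrier M \<and>
    (\<forall>r \<in> carrier R. \<forall>m \<in> carrier M. r \<odot>\<^bsub>M\<^esub> m \<in> P \<longrightarrow> m \<in> P \<or> r \<in> colon R M P)"

definition Spec :: "('a, 'r) ring_scheme \<Rightarrow> ('a, 'b, 'm) module_scheme \<Rightarrow> 'b set set"
  where "Spec R M = {P. prime_submodule R M P}"

(* Multiplicatively closed subsets of R are the submonoids of (R, \<otimes>, \<one>).  A family of such subsets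
   is given by the set of its members, on which alone the set below depends; it may be empty. *)
definition Vtilde :: "('a, 'r) ring_scheme \<Rightarrow> ('a, 'b, 'm) module_scheme \<Rightarrow> 'a set set \<Rightarrow> 'b set set"
  where "Vtilde R M \<S> = {P \<in> Spec R M. \<forall>S \<in> \<S>. colon R M P \<inter> S \<noteq> {}}"

definition Dtilde :: "('a, 'r) ring_scheme \<Rightarrow> ('a, 'b, 'm) module_scheme \<Rightarrow> 'a set \<Rightarrow> 'b set set"
  where "Dtilde R M T = {P \<in> Spec R M. colon R M P \<inter> T = {}}"

definition Spec_top :: "('a, 'r) ring_scheme \<Rightarrow> ('a, 'b, 'm) module_scheme \<Rightarrow> 'b set topology"
  where "Spec_top R M = topology (\<lambda>U. U \<subseteq> Spec R M \<and>
    (\<exists>\<S>. (\<forall>S \<in> \<S>. submonoid S R) \<and> Spec R M - U = Vtilde R M \<S>))"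

(* The submodule JM: all finite sums of products of an element of J and an element of M. *)
inductive_set ideal_smult :: "('a, 'b, 'm) module_scheme \<Rightarrow> 'a set \<Rightarrow> 'b set"
  for M and J where
    prod: "\<lbrakk>a \<in> J; m \<in> carrier M\<rbrakk> \<Longrightarrow> a \<odot>\<^bsub>M\<^esub> m \<in> ideal_smult M J"
  | sum: "\<lbrakk>x \<in> ideal_smult M J; y \<in> ideal_smult M J\<rbrakk> \<Longrightarrow> x \<oplus>\<^bsub>M\<^esub> y \<in> ideal_smult M J"

definition multiplication_module :: "('a, 'r) ring_scheme \<Rightarrow> ('a, 'b, 'm) module_scheme \<Rightarrow> bool"
  where "multiplication_module R M \<longleftrightarrow>
    (\<forall>K. submodule K R M \<longrightarrow> (\<exists>J. ideal J R \<and> K = ideal_smult M J))"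

definition minimal_in :: "'b set set \<Rightarrow> 'b set \<Rightarrow> bool"
  where "minimal_in N P \<longleftrightarrow> P \<in> N \<and> (\<forall>Q \<in> N. Q \<subseteq> P \<longrightarrow> Q = P)"

(* The sets Vtilde R M \<S> do form the closed sets of a topology, so Spec_top is the intended one. *)

lemma (in Module.module) colon_mult_iff:
  assumes P: "P \<in> Spec R M" and s: "s \<in> carrier R" and t: "t \<in> carrier R"
  shows "s \<otimes> t \<in> colon R M P \<longleftrightarrow> s \<in> colon R M P \<or> t \<in> colon R M P"
proof -
  have sub: "submodule P R M" using P by (simp add: Spec_def prime_submodule_def)
  have abs: "x \<otimes> y \<in> colon R M P" if "x \<in> colon R M P" "y \<in> carrier R" for x y
    using that by (auto simp: colon_def smult_assoc1)
  have "s \<in> colon R M P" if st: "s \<otimes> t \<in> colon R M P" and nt: "t \<notin> colon R M P"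
  proof -
    obtain m where m: "m \<in> carrier M" "t \<odot>\<^bsub>M\<^esub> m \<notin> P" using nt t by (auto simp: colon_def)
    have "s \<odot>\<^bsub>M\<^esub> (t \<odot>\<^bsub>M\<^esub> m) \<in> P"
      using st m s t by (auto simp: colon_def smult_assoc1)
    then show ?thesis using P m s t unfolding Spec_def prime_submodule_def by blast
  qed
  moreover have "s \<otimes> t \<in> colon R M P" if "s \<in> colon R M P" using abs[OF that t] .
  moreover have "s \<otimes> t \<in> colon R M P" if "t \<in> colon R M P"
    using abs[OF that s] m_comm[OF s t] by simp
  ultimately show ?thesis by blast
qed

lemma (in Module.module) one_notin_colon:
  assumes P: "P \<in> Spec R M"
  shows "\<one> \<notin> colon R M P"
proof
  assume "\<one> \<in> colon R M P"
  then have "carrier M \<subseteq> P" by (auto simp: colon_def)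
  moreover have "P \<subseteq> carrier M" "P \<noteq> carrier M"
    using P submoduleE(1) by (auto simp: Spec_def prime_submodule_def)
  ultimately show False by blast
qed

lemma (in Module.module) Vtilde_Un:
  assumes A: "\<forall>S \<in> \<A>. submonoid S R" and B: "\<forall>S \<in> \<B>. submonoid S R"
  shows "\<exists>\<C>. (\<forall>S \<in> \<C>. submonoid S R) \<and> Vtilde R M \<A> \<union> Vtilde R M \<B> = Vtilde R M \<C>"
proof -
  define pr where "pr S T = {s \<otimes> t | s t. s \<in> S \<and> t \<in> T}" for S T
  define \<C> where "\<C> = {pr S T | S T. S \<in> \<A> \<and> T \<in> \<B>}"
  have mon: "submonoid (pr S T) R" if S: "submonoid S R" and T: "submonoid T R" for S T
  proof
    show "pr S T \<subseteq> carrier R"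
      using submonoid.subset[OF S] submonoid.subset[OF T] by (auto simp: pr_def)
    show "\<one> \<in> pr S T"
      using submonoid.one_closed[OF S] submonoid.one_closed[OF T] r_one[OF one_closed]
      unfolding pr_def by force
    fix x y assume "x \<in> pr S T" "y \<in> pr S T"
    then obtain a b c d where ab: "a \<in> S" "b \<in> T" "c \<in> S" "d \<in> T" "x = a \<otimes> b" "y = c \<otimes> d"
      by (auto simp: pr_def)
    then have carr: "a \<in> carrier R" "b \<in> carrier R" "c \<in> carrier R" "d \<in> carrier R"
      using submonoid.subset[OF S] submonoid.subset[OF T] by auto
    have "x \<otimes> y = (a \<otimes> c) \<otimes> (b \<otimes> d)"
      using carr ab by (simp add: m_ac)
    moreover have "a \<otimes> c \<in> S" "b \<otimes> d \<in> T"
      using ab submonoid.m_closed[OF S] submonoid.m_closed[OF T] by auto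
    ultimately show "x \<otimes> y \<in> pr S T" by (auto simp: pr_def)
  qed
  have hit: "colon R M P \<inter> pr S T \<noteq> {} \<longleftrightarrow> colon R M P \<inter> S \<noteq> {} \<or> colon R M P \<inter> T \<noteq> {}"
    if P: "P \<in> Spec R M" and S: "submonoid S R" and T: "submonoid T R" for P S T
  proof -
    have c: "s \<otimes> t \<in> colon R M P \<longleftrightarrow> s \<in> colon R M P \<or> t \<in> colon R M P" if "s \<in> S" "t \<in> T" for s t
      using colon_mult_iff[OF P] that submonoid.subset[OF S] submonoid.subset[OF T] by blast
    have "colon R M P \<inter> pr S T \<noteq> {} \<longleftrightarrow> (\<exists>s\<in>S. \<exists>t\<in>T. s \<otimes> t \<in> colon R M P)"
      by (auto simp: pr_def)
    then show ?thesis
      using c submonoid.one_closed[OF S] submonoid.one_closed[OF T] by blast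
  qed
  have "P \<in> Vtilde R M \<A> \<union> Vtilde R M \<B> \<longleftrightarrow> P \<in> Vtilde R M \<C>" for P
  proof (cases "P \<in> Spec R M")
    case True
    have "P \<in> Vtilde R M \<C> \<longleftrightarrow> (\<forall>S\<in>\<A>. \<forall>T\<in>\<B>. colon R M P \<inter> pr S T \<noteq> {})"
      using True by (auto simp: Vtilde_def \<C>_def)
    also have "\<dots> \<longleftrightarrow> (\<forall>S\<in>\<A>. \<forall>T\<in>\<B>. colon R M P \<inter> S \<noteq> {} \<or> colon R M P \<inter> T \<noteq> {})"
      using hit[OF True] A B by simp
    also have "\<dots> \<longleftrightarrow> P \<in> Vtilde R M \<A> \<union> Vtilde R M \<B>"
      using True unfolding Vtilde_def by blast
    finally show ?thesis by simp
  qed (simp add: Vtilde_def)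
  moreover have "\<forall>S \<in> \<C>. submonoid S R" using mon A B by (auto simp: \<C>_def)
  ultimately show ?thesis by blast
qed

lemma (in Module.module) istopology_Spec:
  "istopology (\<lambda>U. U \<subseteq> Spec R M \<and>
    (\<exists>\<S>. (\<forall>S \<in> \<S>. submonoid S R) \<and> Spec R M - U = Vtilde R M \<S>))"
  unfolding istopology_def
proof (intro conjI allI impI)
  fix U V
  assume U: "U \<subseteq> Spec R M \<and> (\<exists>\<S>. (\<forall>S \<in> \<S>. submonoid S R) \<and> Spec R M - U = Vtilde R M \<S>)"
    and V: "V \<subseteq> Spec R M \<and> (\<exists>\<S>. (\<forall>S \<in> \<S>. submonoid S R) \<and> Spec R M - V = Vtilde R M \<S>)"
  show "U \<inter> V \<subseteq> Spec R M" using U by blast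
  show "\<exists>\<S>. (\<forall>S \<in> \<S>. submonoid S R) \<and> Spec R M - U \<inter> V = Vtilde R M \<S>"
    using U V Vtilde_Un by (metis Diff_Int)
next
  fix \<K>
  assume K: "\<forall>U\<in>\<K>. U \<subseteq> Spec R M \<and>
    (\<exists>\<S>. (\<forall>S \<in> \<S>. submonoid S R) \<and> Spec R M - U = Vtilde R M \<S>)"
  show "\<Union>\<K> \<subseteq> Spec R M" using K by blast
  from K obtain f where f: "\<And>U. U \<in> \<K> \<Longrightarrow> (\<forall>S \<in> f U. submonoid S R) \<and> Spec R M - U = Vtilde R M (f U)"
    by metis
  have "P \<in> Spec R M - \<Union>\<K> \<longleftrightarrow> P \<in> Spec R M \<and> (\<forall>U\<in>\<K>. P \<in> Spec R M - U)" for P by blast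
  then have "P \<in> Spec R M - \<Union>\<K> \<longleftrightarrow> P \<in> Spec R M \<and> (\<forall>U\<in>\<K>. P \<in> Vtilde R M (f U))" for P
    using f by blast
  then have "Spec R M - \<Union>\<K> = Vtilde R M (\<Union>(f ` \<K>))"
    unfolding Vtilde_def by blast
  moreover have "\<forall>S \<in> \<Union>(f ` \<K>). submonoid S R" using f by blast
  ultimately show "\<exists>\<S>. (\<forall>S \<in> \<S>. submonoid S R) \<and> Spec R M - \<Union>\<K> = Vtilde R M \<S>" by blast
qed

lemma (in Module.module) topspace_Spec_top: "topspace (Spec_top R M) = Spec R M"
proof -
  have "Vtilde R M {{\<one>}} = {}" using one_notin_colon by (auto simp: Vtilde_def)
  moreover have "submonoid {\<one>} R" by unfold_locales auto
  ultimately have "openin (Spec_top R M) (Spec R M)"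
    unfolding Spec_top_def topology_inverse'[OF istopology_Spec]
    by (intro conjI exI[of _ "{{\<one>}}"]) auto
  moreover have "U \<subseteq> Spec R M" if "openin (Spec_top R M) U" for U
    using that unfolding Spec_top_def topology_inverse'[OF istopology_Spec] by blast
  ultimately show ?thesis by (simp add: openin_subset openin_topspace subset_antisym)
qed

lemma (in Module.module) closedin_Spec_top:
  "closedin (Spec_top R M) C \<longleftrightarrow> (\<exists>\<S>. (\<forall>S \<in> \<S>. submonoid S R) \<and> C = Vtilde R M \<S>)"
proof -
  have "closedin (Spec_top R M) C \<longleftrightarrow> C \<subseteq> Spec R M \<and>
      (\<exists>\<S>. (\<forall>S \<in> \<S>. submonoid S R) \<and> Spec R M - (Spec R M - C) = Vtilde R M \<S>)"
    unfolding closedin_def topspace_Spec_top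
    unfolding Spec_top_def topology_inverse'[OF istopology_Spec] by blast
  moreover have "Vtilde R M \<S> \<subseteq> Spec R M" for \<S> by (auto simp: Vtilde_def)
  ultimately show ?thesis by (metis Diff_Diff_Int inf.absorb_iff2)
qed

end

theory Submission
  imports Defs
begin

text \<open>The closed sets are exactly the subsets of \<open>Spec R M\<close> that are up-closed for the preorder
  \<open>P \<le> Q \<longleftrightarrow> (P:M) \<subseteq> (Q:M)\<close>: the complement of a colon ideal is multiplicatively closed, so it
  separates \<open>Q\<close> from every \<open>P\<close> not below it. Hence closures are up-sets, interiors are given by
  down-sets, and a limit point of \<open>N\<close> is a point with a member of \<open>N\<close> other than itself below it.
  Over a multiplication module the preorder is inclusion, since \<open>P = (P:M)M\<close>.\<close>

context Module.module
begin

lemma submonoid_Diff_colon: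
  assumes "P \<in> Spec R M"
  shows "submonoid (carrier R - colon R M P) R"
  using one_notin_colon[OF assms] colon_mult_iff[OF assms] by unfold_locales auto

lemma closedin_Spec_top_iff:
  "closedin (Spec_top R M) C \<longleftrightarrow>
    C \<subseteq> Spec R M \<and> (\<forall>P\<in>C. \<forall>Q\<in>Spec R M. colon R M P \<subseteq> colon R M Q \<longrightarrow> Q \<in> C)"
  (is "_ \<longleftrightarrow> ?up")
proof
  assume "closedin (Spec_top R M) C"
  then obtain \<S> where "C = Vtilde R M \<S>" by (auto simp: closedin_Spec_top)
  \<comment> \<open>A common element of \<open>colon R M P\<close> and \<open>S\<close> stays in the
    larger \<open>colon R M Q\<close>.\<close>
  then show ?up by (fastforce simp: Vtilde_def)
next
  assume up: ?up
  \<comment> \<open>One multiplicatively closed set for each point \<open>Q\<close> outside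
    \<open>C\<close>; by \<open>hit\<close> it discards exactly the points \<open>P\<close> with
    \<open>colon R M P \<subseteq> colon R M Q\<close>.\<close>
  define \<S> where "\<S> = (\<lambda>Q. carrier R - colon R M Q) ` (Spec R M - C)"
  have hit: "colon R M P \<inter> (carrier R - colon R M Q) \<noteq> {} \<longleftrightarrow> \<not> colon R M P \<subseteq> colon R M Q" for P Q
    by (auto simp: colon_def)
  have "P \<in> Vtilde R M \<S> \<longleftrightarrow>
      P \<in> Spec R M \<and> (\<forall>Q\<in>Spec R M - C. \<not> colon R M P \<subseteq> colon R M Q)" for P
    by (simp add: Vtilde_def \<S>_def hit)
  \<comment> \<open>A point outside \<open>C\<close> is discarded by its own set
    (\<open>Q = P\<close>); a point of \<open>C\<close> never is, since that would place a point
    outside \<open>C\<close> above it.\<close>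
  then have "C = Vtilde R M \<S>" using up by blast
  moreover have "\<forall>S\<in>\<S>. submonoid S R" using submonoid_Diff_colon by (auto simp: \<S>_def)
  ultimately show "closedin (Spec_top R M) C" unfolding closedin_Spec_top by blast
qed

lemma openin_Spec_top_iff:
  "openin (Spec_top R M) U \<longleftrightarrow>
    U \<subseteq> Spec R M \<and> (\<forall>P\<in>U. \<forall>Q\<in>Spec R M. colon R M Q \<subseteq> colon R M P \<longrightarrow> Q \<in> U)"
  unfolding openin_closedin_eq closedin_Spec_top_iff topspace_Spec_top by blast

lemma Dtilde_Diff_colon:
  "Dtilde R M (carrier R - colon R M P) = {Q \<in> Spec R M. colon R M Q \<subseteq> colon R M P}"
  by (auto simp: Dtilde_def colon_def)

text \<open>For a prime \<open>P\<close> this is the least open neighbourhood of \<open>P\<close>,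
  on which limit points are tested.\<close>

lemma openin_Dtilde_Diff_colon:
  "openin (Spec_top R M) (Dtilde R M (carrier R - colon R M P))"
  by (auto simp: openin_Spec_top_iff Dtilde_Diff_colon)

lemma closure_of_Spec_top:
  assumes "N \<subseteq> Spec R M"
  shows "Spec_top R M closure_of N =
    {Q \<in> Spec R M. \<exists>P\<in>N. colon R M P \<subseteq> colon R M Q}" (is "_ = ?C")
proof (rule closure_of_unique)
  show "N \<subseteq> ?C" using assms by blast
  show "closedin (Spec_top R M) ?C" by (auto simp: closedin_Spec_top_iff)
qed (auto simp: closedin_Spec_top_iff)

text \<open>A point in the closure of a union lies above a single point of that union, hence above a
  point of one \<open>F i\<close>; so arbitrary unions behave like finite ones.\<close>

lemma closure_of_UN:
  assumes "\<And>i. i \<in> I \<Longrightarrow> F i \<subseteq> Spec R M"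
  shows "Spec_top R M closure_of (\<Union>i\<in>I. F i) = (\<Union>i\<in>I. Spec_top R M closure_of F i)"
proof -
  have UN: "(\<Union>i\<in>I. F i) \<subseteq> Spec R M" using assms by (rule UN_least)
  have "(\<Union>i\<in>I. Spec_top R M closure_of (F i)) =
      (\<Union>i\<in>I. {Q \<in> Spec R M. \<exists>P\<in>F i. colon R M P \<subseteq> colon R M Q})"
    by (rule SUP_cong[OF refl]) (rule closure_of_Spec_top[OF assms])
  also have "\<dots> = {Q \<in> Spec R M. \<exists>P\<in>\<Union>i\<in>I. F i. colon R M P \<subseteq> colon R M Q}"
    by blast
  finally show ?thesis unfolding closure_of_Spec_top[OF UN] by (rule sym)
qed

lemma interior_of_Spec_top:
  assumes "N \<subseteq> Spec R M"
  shows "Spec_top R M interior_of N =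
    {P \<in> N. Dtilde R M (carrier R - colon R M P) \<subseteq> N}" (is "_ = ?U")
proof (rule interior_of_unique)
  \<comment> \<open>Openness is transitivity: what lies below a point below \<open>P\<close> also
    lies below \<open>P\<close>.\<close>
  show "openin (Spec_top R M) ?U"
    using assms unfolding openin_Spec_top_iff Dtilde_Diff_colon by blast
  fix T assume "T \<subseteq> N" "openin (Spec_top R M) T"
  then show "T \<subseteq> ?U" unfolding openin_Spec_top_iff Dtilde_Diff_colon by blast
qed blast

text \<open>The condition \<open>P \<noteq> Q\<close> compares submodules, not colons: distinct
  primes with equal colons are limit points of each other's singletons.\<close>

lemma derived_set_of_Spec_top:
  assumes "N \<subseteq> Spec R M"
  shows "Spec_top R M derived_set_of N =
    {Q \<in> Spec R M. \<exists>P\<in>N. P \<noteq> Q \<and> colon R M P \<subseteq> colon R M Q}" (is "_ = ?D")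
proof
  show "Spec_top R M derived_set_of N \<subseteq> ?D"
  proof
    fix Q assume Q: "Q \<in> Spec_top R M derived_set_of N"
    then have "Q \<in> Spec R M" by (simp add: in_derived_set_of topspace_Spec_top)
    then have "Q \<in> Dtilde R M (carrier R - colon R M Q)" by (simp add: Dtilde_Diff_colon)
    \<comment> \<open>The limit condition is applied to the least neighbourhood of
      \<open>Q\<close>.\<close>
    then obtain P where "P \<noteq> Q" "P \<in> N" "P \<in> Dtilde R M (carrier R - colon R M Q)"
      using Q openin_Dtilde_Diff_colon unfolding in_derived_set_of by blast
    with \<open>Q \<in> Spec R M\<close> show "Q \<in> ?D" by (auto simp: Dtilde_Diff_colon)
  qed
  show "?D \<subseteq> Spec_top R M derived_set_of N"
    using assms unfolding derived_set_of_def openin_Spec_top_iff topspace_Spec_top by blast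
qed

lemma ideal_smult_subset:
  assumes "submodule K R M" and "J \<subseteq> colon R M K"
  shows "ideal_smult M J \<subseteq> K"
proof
  fix x assume "x \<in> ideal_smult M J"
  then show "x \<in> K"
  proof induction
    case (prod a m)
    then show ?case using assms(2) by (auto simp: colon_def)
  next
    case (sum x y)
    then show ?case using submoduleE(5)[OF assms(1)] by blast
  qed
qed

text \<open>Write \<open>P = JM\<close>. Then \<open>J \<subseteq> (P:M) \<subseteq> (Q:M)\<close>,
  hence \<open>JM \<subseteq> Q\<close>. The converse is monotonicity of the colon.\<close>

lemma colon_subset_iff:
  assumes "multiplication_module R M" and "submodule P R M" and "submodule Q R M"
  shows "colon R M P \<subseteq> colon R M Q \<longleftrightarrow> P \<subseteq> Q"
proof
  assume le: "colon R M P \<subseteq> colon R M Q"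
  obtain J where J: "ideal J R" "P = ideal_smult M J"
    using assms unfolding multiplication_module_def by blast
  then have "J \<subseteq> colon R M P"
    using ideal.Icarr[OF J(1)] by (auto simp: colon_def intro: ideal_smult.prod)
  then show "P \<subseteq> Q" using ideal_smult_subset assms(3) le J(2) by blast
qed (auto simp: colon_def)

lemma derived_set_of_Spec_top_multiplication_module:
  assumes mm: "multiplication_module R M" and N: "N \<subseteq> Spec R M"
  shows "Spec_top R M derived_set_of N =
    Spec_top R M closure_of N - {P \<in> N. minimal_in N P}"
proof -
  have sub: "submodule P R M" if "P \<in> Spec R M" for P
    using that by (simp add: Spec_def prime_submodule_def)
  have le: "colon R M P \<subseteq> colon R M Q \<longleftrightarrow> P \<subseteq> Q" if "P \<in> N" "Q \<in> Spec R M" for P Q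
    by (rule colon_subset_iff[OF mm sub[OF subsetD[OF N that(1)]] sub[OF that(2)]])
  have closure: "Spec_top R M closure_of N = {Q \<in> Spec R M. \<exists>P\<in>N. P \<subseteq> Q}"
    \<comment> \<open>The congruence rules supply the memberships of \<open>P\<close> and
      \<open>Q\<close> that \<open>le\<close> requires.\<close>
    unfolding closure_of_Spec_top[OF N] by (simp add: le cong: conj_cong bex_cong)
  \<comment> \<open>Let a member of \<open>N\<close> lie below a non-minimal \<open>Q\<close>. If
    \<open>Q\<close> is not in \<open>N\<close>, that member differs from \<open>Q\<close>;
    otherwise non-minimality gives a strictly smaller one.\<close>
  have minimal: "(\<exists>P\<in>N. P \<noteq> Q \<and> P \<subseteq> Q) \<longleftrightarrow> (\<exists>P\<in>N. P \<subseteq> Q) \<and> \<not> minimal_in N Q" for Q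
    unfolding minimal_in_def by metis
  have "Spec_top R M derived_set_of N = {Q \<in> Spec R M. \<exists>P\<in>N. P \<noteq> Q \<and> P \<subseteq> Q}"
    unfolding derived_set_of_Spec_top[OF N] by (simp add: le cong: conj_cong bex_cong)
  also have "\<dots> = {Q \<in> Spec R M. \<exists>P\<in>N. P \<subseteq> Q} - {P \<in> N. minimal_in N P}"
    unfolding minimal by (auto simp: minimal_in_def)
  finally show ?thesis unfolding closure .
qed

end

theorem theorem7:
  fixes R :: "('a, 'r) ring_scheme"
    and M :: "('a, 'b, 'm) module_scheme"
    and N :: "'b set set"
  assumes "Module.module R M"
    and "Spec R M \<noteq> {}"
    and "N \<subseteq> Spec R M"
  shows "Spec_top R M closure_of N =
           {Q \<in> Spec R M. \<exists>P \<in> N. colon R M P \<subseteq> colon R M Q} \<and>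
         (\<forall>(I :: 'i set) F. (\<forall>i \<in> I. F i \<subseteq> Spec R M) \<longrightarrow>
           Spec_top R M closure_of (\<Union>i \<in> I. F i) = (\<Union>i \<in> I. Spec_top R M closure_of F i)) \<and>
         Spec_top R M interior_of N =
           {P \<in> N. Dtilde R M (carrier R - colon R M P) \<subseteq> N} \<and>
         (multiplication_module R M \<longrightarrow>
           Spec_top R M derived_set_of N =
             Spec_top R M closure_of N - {P \<in> N. minimal_in N P})"
proof (intro conjI allI impI)
  interpret Module.module R M by fact
  show "Spec_top R M closure_of N = {Q \<in> Spec R M. \<exists>P\<in>N. colon R M P \<subseteq> colon R M Q}"
    by (rule closure_of_Spec_top) fact
  show "Spec_top R M interior_of N = {P \<in> N. Dtilde R M (carrier R - colon R M P) \<subseteq> N}"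
    by (rule interior_of_Spec_top) fact
  show "Spec_top R M closure_of (\<Union>i\<in>I. F i) = (\<Union>i\<in>I. Spec_top R M closure_of F i)"
    if F: "\<forall>i\<in>I. F i \<subseteq> Spec R M" for I :: "'i set" and F
    using F by (intro closure_of_UN) simp
  show "Spec_top R M derived_set_of N = Spec_top R M closure_of N - {P \<in> N. minimal_in N P}"
    if "multiplication_module R M"
    using that assms(3) by (rule derived_set_of_Spec_top_multiplication_module)
qed

end
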